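(* Let $L<M<M'<H$ be reals. For the $1$-item procurement auction with two agents over the four-values domain $\Theta=\{L,M,M',H\}^2$, there is no bribeproof mechanism $(A,p)$ whose algorithm $A$ always selects an agent with smallest reported type.
   Context: In the $1$-item procurement auction with two agents, the feasible allocations are $(1,0)$ and $(0,1)$ (exactly one agent is selected). Agent $i$ has private type $\theta_i\in\Theta_i$ and her cost for allocation $a$ is $a_i\theta_i$. $\Theta=\Theta_1\times\Theta_2$. A mechanism is a pair $(A,p)$ with $A$ mapping each $\theta\in\Theta$ to a feasible allocation and $p:\Theta\to\mathbb{R}^2$ giving payments to the agents; the algorithm selects an agent of minimum reported type (ties broken arbitrarily). $(A,p)$ is bribeproof if for all $\theta\in\Theta$, all agents $i,j$ and all $\hat\theta_i\in\Theta_i$, with $\hat\theta$ denoting $\theta$ with its $i$-th entry replaced by $\hat\theta_i$: if $i\neq j$, $p_i(\theta)-A_i(\theta)\theta_i+p_j(\theta)-A_j(\theta)\theta_j\ge p_i(\hat\theta)-A_i(\hat\theta)\theta_i+p_j(\hat\theta)-A_j(\hat\theta)\theta_j$; and, for $i=j$, $p_i(\theta)-A_i(\theta)\theta_i\ge p_i(\hat\theta)-A_i(\hat\theta)\theta_i$. *)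

theory Defs
  imports "HOL-Analysis.Analysis"
begin

(* Agents are the elements of a finite index type 'n; type profiles, allocations and payment
   vectors are elements of real^'n.  A mechanism is a pair (A, p) of HOL functions, total on
   real^'n; everything below constrains them only on the domain given by \<Theta>. *)

definition profiles :: "('n::finite \<Rightarrow> real set) \<Rightarrow> (real^'n) set" where
  "profiles \<Theta> = {\<theta>. \<forall>i. \<theta> $ i \<in> \<Theta> i}"

definition replace_entry :: "real^'n \<Rightarrow> 'n::finite \<Rightarrow> real \<Rightarrow> real^'n" where
  "replace_entry \<theta> i t = (\<chi> k. if k = i then t else \<theta> $ k)"

definition is_mechanism ::
    "(real^'n) set \<Rightarrow> ('n::finite \<Rightarrow> real set) \<Rightarrow> (real^'n \<Rightarrow> real^'n) \<times> (real^'n \<Rightarrow> real^'n) \<Rightarrow> bool" where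
  "is_mechanism F \<Theta> = (\<lambda>(A, p). \<forall>\<theta>\<in>profiles \<Theta>. A \<theta> \<in> F)"

(* The utility is evaluated at a true type t and a reported profile r. *)
definition utility ::
    "(real^'n \<Rightarrow> real^'n) \<times> (real^'n \<Rightarrow> real^'n) \<Rightarrow> 'n::finite \<Rightarrow> real \<Rightarrow> real^'n \<Rightarrow> real" where
  "utility = (\<lambda>(A, p) i t r. p r $ i - A r $ i * t)"

definition bribeproof ::
    "('n::finite \<Rightarrow> real set) \<Rightarrow> (real^'n \<Rightarrow> real^'n) \<times> (real^'n \<Rightarrow> real^'n) \<Rightarrow> bool" where
  "bribeproof \<Theta> m \<longleftrightarrow>
    (\<forall>\<theta>\<in>profiles \<Theta>. \<forall>i j. \<forall>t\<in>\<Theta> i.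
      (i \<noteq> j \<longrightarrow>
        utility m i (\<theta> $ i) \<theta> + utility m j (\<theta> $ j) \<theta>
          \<ge> utility m i (\<theta> $ i) (replace_entry \<theta> i t) + utility m j (\<theta> $ j) (replace_entry \<theta> i t)) \<and>
      (i = j \<longrightarrow>
        utility m i (\<theta> $ i) \<theta> \<ge> utility m i (\<theta> $ i) (replace_entry \<theta> i t)))"

definition one_item_allocations :: "(real^2) set" where
  "one_item_allocations = {vector [1, 0], vector [0, 1]}"

(* Ties are unconstrained: at each profile any agent of minimum type may be selected. *)
definition selects_min ::
    "('n::finite \<Rightarrow> real set) \<Rightarrow> (real^'n \<Rightarrow> real^'n) \<Rightarrow> bool" where
  "selects_min \<Theta> A \<longleftrightarrow>
    (\<forall>\<theta>\<in>profiles \<Theta>. \<forall>i. A \<theta> $ i = 1 \<longrightarrow> (\<forall>j. \<theta> $ i \<le> \<theta> $ j))"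

end

(* Two reports of one agent that yield the same allocation leave both payments unchanged, so the
   payments depend only on the winner: (u1, u2) if agent 1 wins and (d1, d2) if agent 2 wins.
   By symmetry let agent 1 win at (L, L).  Her misreport M there, as a bribe, gives
   u1 + u2 \<ge> d1 + d2, and truthfulness at (M, L) gives u1 - d1 \<le> M, hence also d2 - u2 \<le> M.
   At (H, H) one agent loses; truthfulness of that agent when she has type M' and wins against H
   gives M' \<le> u1 - d1 or M' \<le> d2 - u2, contradicting M < M'. *)
theory Submission imports Defs
begin

text \<open>Allocations and payments are curried functions of the two reports, so that exchanging
  the agents is a swap of arguments. The digit in \<open>bribe1\<close> and \<open>bribe2\<close>
  names the agent who misreports. Ties stay open.\<close>

locale bribeproof_auction =
  fixes S :: "real set" and a1 a2 q1 q2 :: "real \<Rightarrow> real \<Rightarrow> real"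
  assumes winner: "x \<in> S \<Longrightarrow> y \<in> S \<Longrightarrow> a1 x y = 1 \<and> a2 x y = 0 \<or> a1 x y = 0 \<and> a2 x y = 1"
    and min1: "x \<in> S \<Longrightarrow> y \<in> S \<Longrightarrow> x < y \<Longrightarrow> a1 x y = 1"
    and min2: "x \<in> S \<Longrightarrow> y \<in> S \<Longrightarrow> y < x \<Longrightarrow> a2 x y = 1"
    and truthful1: "x \<in> S \<Longrightarrow> y \<in> S \<Longrightarrow> t \<in> S \<Longrightarrow>
          q1 t y - a1 t y * x \<le> q1 x y - a1 x y * x"
    and truthful2: "x \<in> S \<Longrightarrow> y \<in> S \<Longrightarrow> t \<in> S \<Longrightarrow>
          q2 x t - a2 x t * y \<le> q2 x y - a2 x y * y"
    and bribe1: "x \<in> S \<Longrightarrow> y \<in> S \<Longrightarrow> t \<in> S \<Longrightarrow>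
          q1 t y - a1 t y * x + (q2 t y - a2 t y * y) \<le> q1 x y - a1 x y * x + (q2 x y - a2 x y * y)"
    and bribe2: "x \<in> S \<Longrightarrow> y \<in> S \<Longrightarrow> t \<in> S \<Longrightarrow>
          q1 x t - a1 x t * x + (q2 x t - a2 x t * y) \<le> q1 x y - a1 x y * x + (q2 x y - a2 x y * y)"
begin

text \<open>Serves to carry the case of a tie won by agent 1 over to agent 2.\<close>

lemma swap: "bribeproof_auction S (\<lambda>x y. a2 y x) (\<lambda>x y. a1 y x) (\<lambda>x y. q2 y x) (\<lambda>x y. q1 y x)"
proof
  fix x y assume "x \<in> S" "y \<in> S"
  then show "a2 y x = 1 \<and> a1 y x = 0 \<or> a2 y x = 0 \<and> a1 y x = 1"
    using winner[of y x] by blast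
next
  fix x y t assume S: "x \<in> S" "y \<in> S" "t \<in> S"
  show "q2 y t - a2 y t * x + (q1 y t - a1 y t * y) \<le> q2 y x - a2 y x * x + (q1 y x - a1 y x * y)"
    using bribe2[of y x t] S by linarith
  show "q2 t x - a2 t x * x + (q1 t x - a1 t x * y) \<le> q2 y x - a2 y x * x + (q1 y x - a1 y x * y)"
    using bribe1[of y x t] S by linarith
qed (simp_all add: min1 min2 truthful1 truthful2)

text \<open>Truthfulness in both directions fixes \<open>q1\<close>; the bribe inequality in both
  directions then fixes \<open>q1 + q2\<close>, hence \<open>q2\<close>.\<close>

lemma payments_eq1:
  assumes "x \<in> S" "y \<in> S" "t \<in> S" "a1 t y = a1 x y"
  shows "q1 t y = q1 x y \<and> q2 t y = q2 x y"
proof -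
  have "a2 t y = a2 x y"
    using winner[of x y] winner[of t y] assms by auto
  then show ?thesis
    using truthful1[of x y t] truthful1[of t y x] bribe1[of x y t] bribe1[of t y x] assms by simp
qed

lemma payments_eq2:
  assumes "x \<in> S" "y \<in> S" "t \<in> S" "a1 x t = a1 x y"
  shows "q1 x t = q1 x y \<and> q2 x t = q2 x y"
proof -
  have "a2 x t = a2 x y"
    using winner[of x y] winner[of x t] assms by auto
  then show ?thesis
    using truthful2[of x y t] truthful2[of x t y] bribe2[of x y t] bribe2[of x t y] assms by simp
qed

lemma not_selects_first_at_bottom:
  assumes S: "L \<in> S" "M \<in> S" "M' \<in> S" "H \<in> S"
    and less: "L < M" "M < M'" "M' < H"
  shows "a1 L L \<noteq> 1"
proof
  assume LL: "a1 L L = 1"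
  then have LL2: "a2 L L = 0"
    using winner[of L L] S by auto
  have less': "L < M'" "L < H" "M < H"
    using less by auto
  have up: "a1 x y = 1 \<and> a2 x y = 0" if "x \<in> S" "y \<in> S" "x < y" for x y
    using winner[of x y] min1[of x y] that by auto
  have down: "a1 x y = 0 \<and> a2 x y = 1" if "x \<in> S" "y \<in> S" "y < x" for x y
    using winner[of x y] min2[of x y] that by auto
  \<comment> \<open>Walk (L,L), (L,M), (L,M'), (M,M'), (M,H), (M',H): one report changes at a time,
    and after the first point the path stays strictly on agent 1's side of the diagonal, away from
    ties.\<close>
  have upper: "q1 M' H = q1 L L" "q2 M' H = q2 L L"
    using payments_eq2[of L M L] payments_eq2[of L M' M] payments_eq1[of M M' L]
      payments_eq2[of M H M'] payments_eq1[of M' H M]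
    by (simp_all add: up S less less' LL)
  \<comment> \<open>Likewise on agent 2's side: (M,L), (M',L), (M',M), (H,M), (H,M').\<close>
  have lower: "q1 H M' = q1 M L" "q2 H M' = q2 M L"
    using payments_eq1[of M' L M] payments_eq2[of M' M L] payments_eq1[of H M M']
      payments_eq2[of H M' M]
    by (simp_all add: down S less less')
  \<comment> \<open>Both true types are L, so the cost is the same whoever wins and only payments
    remain.\<close>
  have sum: "q1 M L + q2 M L \<le> q1 L L + q2 L L"
    using bribe1[of L L M] by (simp add: down S less LL LL2)
  have gap: "q1 L L - M \<le> q1 M L"
    using truthful1[of M L L] by (simp add: down S less LL LL2)
  from winner[OF S(4) S(4)] show False
  proof
    \<comment> \<open>Agent 2 loses at (H,H), where the payments are those of \<open>upper\<close>.
      With true type M' she must not gain by reporting H, so winning pays her at least M' more;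
      \<open>sum\<close> and \<open>gap\<close> allow at most M.\<close>
    assume HH: "a1 H H = 1 \<and> a2 H H = 0"
    then have "q2 H H = q2 M' H"
      using payments_eq1[of M' H H] by (simp add: up S less)
    moreover have "q2 H H \<le> q2 H M' - M'"
      using truthful2[of H M' H] by (simp add: down S less HH)
    ultimately show False
      using upper lower sum gap less by linarith
  next
    \<comment> \<open>Now agent 1 loses, the payment \<open>q1 H H\<close> is that of
      \<open>lower\<close>, and her premium for winning contradicts \<open>gap\<close>
      directly.\<close>
    assume HH: "a1 H H = 0 \<and> a2 H H = 1"
    then have "q1 H H = q1 H M'"
      using payments_eq2[of H M' H] by (simp add: down S less)
    moreover have "q1 H H \<le> q1 M' H - M'"
      using truthful1[of M' H H] by (simp add: up S less HH)
    ultimately show False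
      using upper lower gap less by linarith
  qed
qed

text \<open>Whoever wins at (L,L), one of the two orderings of the agents makes her the
  first.\<close>

lemma no_four_types:
  assumes "L \<in> S" "M \<in> S" "M' \<in> S" "H \<in> S" "L < M" "M < M'" "M' < H"
  shows False
  using winner[of L L] not_selects_first_at_bottom[OF assms]
    bribeproof_auction.not_selects_first_at_bottom[OF swap assms] assms by blast

end

lemma replace_entry_vector:
  "replace_entry (vector [x, y] :: real^2) 1 t = vector [t, y]"
  "replace_entry (vector [x, y] :: real^2) 2 t = vector [x, t]"
  by (simp_all add: replace_entry_def vec_eq_iff forall_2)

lemma bribeproof_auctionI:
  assumes mech: "is_mechanism one_item_allocations (\<lambda>_. S) (A, p)"
    and bp: "bribeproof (\<lambda>_. S) (A, p)"
    and sel: "selects_min (\<lambda>_. S) A"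
  shows "bribeproof_auction S (\<lambda>x y. A (vector [x, y]) $ 1) (\<lambda>x y. A (vector [x, y]) $ 2)
    (\<lambda>x y. p (vector [x, y]) $ 1) (\<lambda>x y. p (vector [x, y]) $ 2)"
proof -
  have prof: "(vector [x, y] :: real^2) \<in> profiles (\<lambda>_. S)" if "x \<in> S" "y \<in> S" for x y
    using that by (simp add: profiles_def forall_2)
  have win: "A (vector [x, y]) $ 1 = 1 \<and> A (vector [x, y]) $ 2 = 0 \<or>
      A (vector [x, y]) $ 1 = 0 \<and> A (vector [x, y]) $ 2 = 1" if "x \<in> S" "y \<in> S" for x y
    using mech prof[OF that] by (force simp: is_mechanism_def one_item_allocations_def)
  have le: "(A (vector [x, y]) $ 1 = 1 \<longrightarrow> x \<le> y) \<and> (A (vector [x, y]) $ 2 = 1 \<longrightarrow> y \<le> x)"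
    if "x \<in> S" "y \<in> S" for x y
    using sel prof[OF that] by (force simp: selects_min_def forall_2)
  note ineqs = bp[unfolded bribeproof_def utility_def, rule_format, OF prof]
  show ?thesis
  proof
    fix x y t assume S: "x \<in> S" "y \<in> S" "t \<in> S"
    let ?a = "\<lambda>x y. A (vector [x, y])" and ?q = "\<lambda>x y. p (vector [x, y])"
    \<comment> \<open>The first index is the agent who misreports, the second the one who bribes
      her; equal indices give truthfulness.\<close>
    note bp_at = ineqs[OF S]
    show "?q t y $ 1 - ?a t y $ 1 * x \<le> ?q x y $ 1 - ?a x y $ 1 * x"
      using bp_at[of 1 1] by (simp add: replace_entry_vector)
    show "?q x t $ 2 - ?a x t $ 2 * y \<le> ?q x y $ 2 - ?a x y $ 2 * y"
      using bp_at[of 2 2] by (simp add: replace_entry_vector)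
    show "?q t y $ 1 - ?a t y $ 1 * x + (?q t y $ 2 - ?a t y $ 2 * y)
        \<le> ?q x y $ 1 - ?a x y $ 1 * x + (?q x y $ 2 - ?a x y $ 2 * y)"
      using bp_at[of 1 2] by (simp add: replace_entry_vector)
    show "?q x t $ 1 - ?a x t $ 1 * x + (?q x t $ 2 - ?a x t $ 2 * y)
        \<le> ?q x y $ 1 - ?a x y $ 1 * x + (?q x y $ 2 - ?a x y $ 2 * y)"
      using bp_at[of 2 1] by (simp add: replace_entry_vector)
  \<comment> \<open>If a strictly smaller report lost, \<open>win\<close> would select the larger
    one, against \<open>le\<close>.\<close>
  qed (use win le in fastforce)+
qed

theorem corollary21:
  fixes L M M' H :: real
  assumes "L < M" and "M < M'" and "M' < H"
  shows "\<not> (\<exists>A p. is_mechanism one_item_allocations (\<lambda>_. {L, M, M', H}) (A, p) \<and>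
                  bribeproof (\<lambda>_. {L, M, M', H}) (A, p) \<and>
                  selects_min (\<lambda>_. {L, M, M', H}) A)"
proof clarify
  fix A p
  assume "is_mechanism one_item_allocations (\<lambda>_. {L, M, M', H}) (A, p)"
    "bribeproof (\<lambda>_. {L, M, M', H}) (A, p)" "selects_min (\<lambda>_. {L, M, M', H}) A"
  then show False
    using bribeproof_auction.no_four_types[OF bribeproof_auctionI, of "{L, M, M', H}" A p L M M' H]
      assms by simp
qed

end
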